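(* In the setting of the context, suppose there exist $\rho>0$, constants $c_1,c_2$ and $\lambda$ with $c_2\frac{r(\rho)^2}{\rho}\le\lambda\le c_1\frac{r(\rho)^2}{\rho}$ such that 1. $\Lambda_Q>2(\Lambda_M+\Lambda_{\mathcal V})+c_1$ and $c_2\ge4(\Lambda_M+\Lambda_{\mathcal V})$; 2. $\Delta(\eta\theta_*,\rho)\ge\frac34\rho$. Then, with probability at least $1-p_{\mathcal Q}-p_{\mathcal M}$, one has $\mathcal P_N\mathcal L^\lambda_{\theta-\eta\theta_*}>0$ for every $\theta\in\mathbb R^d$ with $\theta\notin B_2(\eta\theta_*,r(\rho))\cap B_\Psi(\eta\theta_*,\rho)$.
   Context: Let $(\mathbf x_i,y_i)$, $i=1,\dots,N$, be i.i.d. copies of $(\mathbf x,y)$, with $\mathbf x\in\mathbb R^d$, $\mathbb E[\mathbf x]=0$, $y=f(\langle\mathbf x,\theta_*\rangle,\xi)$, $\xi$ a real-valued noise independent of $\mathbf x$, satisfying for some $q>0$ and constants $\nu,\nu_q,\kappa>0$: $\sup_{\mathbf v\in\mathbb S^{d-1}}\mathbb E|\langle\mathbf x,\mathbf v\rangle|^4\le\nu$; $\mathbb E[|y|^q]^{1/q}\le\nu_q$, $\mathbb E[|x_j|^q]^{1/q}\le\nu_q$ for all coordinates $x_j$; $\inf_{\mathbf v\in\mathbb S^{d-1}}\mathbb E|\langle\mathbf x,\mathbf v\rangle|^2\ge\kappa$. Let $\eta=\mathbb E[y\langle\mathbf x,\theta_*\rangle]/\|\mathbf\Sigma^{1/2}\theta_*\|_2^2$,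 $\mathbf\Sigma=\mathbb E[\mathbf x\mathbf x^T]$, assumed nonzero. Let $\Psi$ be a norm on $\mathbb R^d$. $(\widetilde{\mathbf x}_i,\widetilde y_i)$ are truncated versions of $(\mathbf x_i,y_i)$ of either of the following problem-specific forms: (i) $\widetilde x_{ij}=\mathrm{sign}(x_{ij})(|x_{ij}|\wedge\tau)$, $\widetilde y_i=\mathrm{sign}(y_i)(|y_i|\wedge\tau)$, $\tau=(N/\log(ed))^{1/4}$; or (ii) $\widetilde{\mathbf x}_i=\frac{\sqrt d\mathbf x_i}{\|\mathbf x_i\|_2}\big(\frac{\|\mathbf x_i\|_2}{\sqrt d}\wedge\tau\big)$, $\widetilde y_i=\mathrm{sign}(y_i)(|y_i|\wedge\tau)$, $\tau=N^{2/(q+4)}$; $(\widetilde{\mathbf x},\widetilde y)$ denotes the same truncation of $(\mathbf x,y)$. For $\mathbf v\in\mathbb R^d$ put $\mathcal Q_{\mathbf v}=\langle\widetilde{\mathbf x},\mathbf v\rangle^2$, $\mathcal M_{\mathbf v}=(\widetilde y-\langle\widetilde{\mathbf x},\eta\theta_*\rangle)\langle\widetilde{\mathbf x},\mathbf v\rangle-\mathbb E[(\widetilde y-\langle\widetilde{\mathbf x},\eta\theta_*\rangle)\langle\widetilde{\mathbf x},\mathbf v\rangle]$, $\mathcal V_{\mathbf v}=\mathbb E[(\widetilde y-\langle\widetilde{\mathbf x},\eta\theta_*\rangle)\langle\widetilde{\mathbf x},\mathbf v\rangle]$, $\mathcal L^\lambda_{\mathbf v}=\mathcal Q_{\mathbf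 v}-2\mathcal M_{\mathbf v}-2\mathcal V_{\mathbf v}+\lambda(\Psi(\eta\theta_*+\mathbf v)-\Psi(\eta\theta_* ))$, and let $\mathcal P_N$ denote the empirical average over the $N$ samples (e.g. $\mathcal P_N\mathcal Q_{\mathbf v}=\frac1N\sum_i\langle\widetilde{\mathbf x}_i,\mathbf v\rangle^2$). $B_2(\mathbf a,r),S_2(\mathbf a,r)$ (resp. $B_\Psi(\mathbf a,r),S_\Psi(\mathbf a,r)$) denote the ball and sphere of radius $r$ centered at $\mathbf a$ for the Euclidean norm (resp. $\Psi$). Given positive constants $\Lambda_Q,\Lambda_M,\Lambda_{\mathcal V}$, $\rho>0$ and $p_{\mathcal Q},p_{\mathcal M}\in(0,1)$, define $r_{\mathcal Q}=\inf\{r>0:\Pr(\inf_{\theta\in S_2(\eta\theta_*,r)\cap B_\Psi(\eta\theta_*,\rho)}\mathcal P_N\mathcal Q_{\theta-\eta\theta_*}\ge\Lambda_Qr^2)\ge1-p_{\mathcal Q}\}$, $r_{\mathcal V}=\inf\{r>0:\sup_{\theta\in B_2(\eta\theta_*,r)\cap B_\Psi(\eta\theta_*,\rho)}|\mathcal V_{\theta-\eta\theta_*}|\le\Lambda_{\mathcal V}r^2\}$, $r_{\mathcal M}=\inf\{r>0:\Pr(\sup_{\theta\in B_2(\eta\theta_*,r)\cap B_\Psi(\eta\theta_*,\rho)}|\mathcal P_N\mathcal M_{\theta-\eta\theta_*}|\le\Lambda_Mr^2)\ge1-p_{\mathcal M}\}$, $r(\rho)=\max\{r_{\mathcal Q},r_{\mathcal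 M},r_{\mathcal V}\}$. Let $\Gamma_\Psi(\eta\theta_*,\rho)$ be the set of all $\mathbf z\in\mathbb R^d$ for which there exists $\mathbf u\in B_\Psi(\eta\theta_*,\rho/16)$ with $\Psi(\mathbf u+\mathbf h)-\Psi(\mathbf u)\ge\langle\mathbf z,\mathbf h\rangle$ for all $\mathbf h\in\mathbb R^d$, and $$\Delta(\eta\theta_*,\rho)=\inf_{\theta\in B_2(\eta\theta_*,r(\rho))\cap S_\Psi(\eta\theta_*,\rho)}\ \sup_{\mathbf z\in\Gamma_\Psi(\eta\theta_*,\rho)}\langle\mathbf z,\theta-\eta\theta_*\rangle.$$ *)

theory Defs
  imports "HOL-Probability.Probability"
begin

definition is_norm :: "('a::real_vector \<Rightarrow> real) \<Rightarrow> bool" where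
  "is_norm \<Psi> \<longleftrightarrow>
     (\<forall>u. 0 \<le> \<Psi> u) \<and> (\<forall>u. \<Psi> u = 0 \<longleftrightarrow> u = 0) \<and>
     (\<forall>c u. \<Psi> (c *\<^sub>R u) = \<bar>c\<bar> * \<Psi> u) \<and>
     (\<forall>u v. \<Psi> (u + v) \<le> \<Psi> u + \<Psi> v)"

definition norm_ball :: "('a::real_vector \<Rightarrow> real) \<Rightarrow> 'a \<Rightarrow> real \<Rightarrow> 'a set" where
  "norm_ball \<Psi> a r = {u. \<Psi> (u - a) \<le> r}"

definition norm_sphere :: "('a::real_vector \<Rightarrow> real) \<Rightarrow> 'a \<Rightarrow> real \<Rightarrow> 'a set" where
  "norm_sphere \<Psi> a r = {u. \<Psi> (u - a) = r}"

text \<open>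
  The independence of \<open>x\<close> and \<open>\<xi>\<close> is spelled out through the generated sigma-algebras because
  the library's \<open>indep_var\<close> requires both variables to have the same value type. The suprema and
  infima of second and fourth moments are taken in \<open>ennreal\<close>, so that the bounds include the
  existence of these moments. The link function \<open>f\<close> may be any function for which \<open>y\<close> is a random
  variable.
\<close>

locale single_index_model = prob_space M
  for M :: "'w measure" +
  fixes x :: "'w \<Rightarrow> real ^ 'n" and y :: "'w \<Rightarrow> real" and \<xi> :: "'w \<Rightarrow> real"
    and f :: "real \<Rightarrow> real \<Rightarrow> real" and \<theta>\<^sub>0 :: "real ^ 'n"
    and q \<nu> \<nu>\<^sub>q \<kappa> :: real
  assumes x_rv: "x \<in> borel_measurable M"
    and y_rv: "y \<in> borel_measurable M"
    and noise_rv: "\<xi> \<in> borel_measurable M"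
    and noise_indep:
      "indep_set {x -` A \<inter> space M | A. A \<in> sets borel} {\<xi> -` B \<inter> space M | B. B \<in> sets borel}"
    and y_eq: "\<And>\<omega>. \<omega> \<in> space M \<Longrightarrow> y \<omega> = f (x \<omega> \<bullet> \<theta>\<^sub>0) (\<xi> \<omega>)"
    and params_pos: "0 < q" "0 < \<nu>" "0 < \<nu>\<^sub>q" "0 < \<kappa>"
    and x_integrable: "integrable M x"
    and x_centered: "expectation x = 0"
    and x_fourth_moment:
      "(SUP v\<in>sphere 0 1. \<integral>\<^sup>+\<omega>. ennreal (\<bar>x \<omega> \<bullet> v\<bar> ^ 4) \<partial>M) \<le> ennreal \<nu>"
    and y_moment: "integrable M (\<lambda>\<omega>. \<bar>y \<omega>\<bar> powr q)"
      "expectation (\<lambda>\<omega>. \<bar>y \<omega>\<bar> powr q) powr (1 / q) \<le> \<nu>\<^sub>q"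
    and x_moment: "\<And>j. integrable M (\<lambda>\<omega>. \<bar>x \<omega> $ j\<bar> powr q)"
      "\<And>j. expectation (\<lambda>\<omega>. \<bar>x \<omega> $ j\<bar> powr q) powr (1 / q) \<le> \<nu>\<^sub>q"
    and x_nondegenerate:
      "(INF v\<in>sphere 0 1. \<integral>\<^sup>+\<omega>. ennreal (\<bar>x \<omega> \<bullet> v\<bar>\<^sup>2) \<partial>M) \<ge> ennreal \<kappa>"
    and y_x_integrable: "integrable M (\<lambda>\<omega>. y \<omega> * (x \<omega> \<bullet> \<theta>\<^sub>0))"

locale single_index_sample = single_index_model M x y \<xi> f \<theta>\<^sub>0 q \<nu> \<nu>\<^sub>q \<kappa>
  for M :: "'w measure" and x :: "'w \<Rightarrow> real ^ 'n" and y \<xi> f \<theta>\<^sub>0 q \<nu> \<nu>\<^sub>q \<kappa> +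
  fixes N :: nat and X :: "nat \<Rightarrow> 'w \<Rightarrow> real ^ 'n" and Y :: "nat \<Rightarrow> 'w \<Rightarrow> real"
  assumes sample_size: "0 < N"
    and sample_indep: "indep_vars (\<lambda>_. borel) (\<lambda>i \<omega>. (X i \<omega>, Y i \<omega>)) {..<N}"
    and sample_distr: "\<And>i. i < N \<Longrightarrow>
      distr M borel (\<lambda>\<omega>. (X i \<omega>, Y i \<omega>)) = distr M borel (\<lambda>\<omega>. (x \<omega>, y \<omega>))"

definition covariance_matrix :: "'w measure \<Rightarrow> ('w \<Rightarrow> real ^ 'n) \<Rightarrow> real ^ 'n ^ 'n" where
  "covariance_matrix M x = (\<chi> i j. \<integral>\<omega>. x \<omega> $ i * x \<omega> $ j \<partial>M)"

text \<open>The unique symmetric positive semidefinite square root of a matrix of the same kind.\<close>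

definition matrix_sqrt :: "real ^ 'n ^ 'n \<Rightarrow> real ^ 'n ^ 'n" where
  "matrix_sqrt A = (THE B. transpose B = B \<and> (\<forall>v. 0 \<le> v \<bullet> (B *v v)) \<and> B ** B = A)"

definition scale_factor ::
    "'w measure \<Rightarrow> ('w \<Rightarrow> real ^ 'n) \<Rightarrow> ('w \<Rightarrow> real) \<Rightarrow> real ^ 'n \<Rightarrow> real" where
  "scale_factor M x y \<theta>\<^sub>0 =
     (\<integral>\<omega>. y \<omega> * (x \<omega> \<bullet> \<theta>\<^sub>0) \<partial>M) / (norm (matrix_sqrt (covariance_matrix M x) *v \<theta>\<^sub>0))\<^sup>2"

definition trunc_real :: "real \<Rightarrow> real \<Rightarrow> real" where
  "trunc_real \<tau> a = sgn a * min \<bar>a\<bar> \<tau>"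

definition trunc_coord :: "real \<Rightarrow> real ^ 'n \<Rightarrow> real ^ 'n" where
  "trunc_coord \<tau> u = (\<chi> j. trunc_real \<tau> (u $ j))"

text \<open>Division by zero yields \<open>trunc_radial \<tau> 0 = 0\<close>.\<close>

definition trunc_radial :: "real \<Rightarrow> real ^ 'n \<Rightarrow> real ^ 'n" where
  "trunc_radial \<tau> u =
     min (norm u / sqrt (real CARD('n))) \<tau> *\<^sub>R ((sqrt (real CARD('n)) / norm u) *\<^sub>R u)"

definition admissible_truncation ::
    "nat \<Rightarrow> real \<Rightarrow> ((real ^ 'n) \<times> real \<Rightarrow> (real ^ 'n) \<times> real) \<Rightarrow> bool" where
  "admissible_truncation N q T \<longleftrightarrow>
     (let \<tau> = (real N / ln (exp 1 * real CARD('n))) powr (1 / 4)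
      in T = (\<lambda>(u, a). (trunc_coord \<tau> u, trunc_real \<tau> a))) \<or>
     (let \<tau> = real N powr (2 / (q + 4))
      in T = (\<lambda>(u, a). (trunc_radial \<tau> u, trunc_real \<tau> a)))"

text \<open>
  From here on, \<open>Z\<close> is the truncated pair with population law, \<open>Zs i\<close> are the truncated samples, and
  \<open>w\<close> is the target vector, that is, the scale factor times \<open>\<theta>\<^sub>0\<close>.
\<close>

definition Q_proc :: "real ^ 'n \<Rightarrow> (real ^ 'n) \<times> real \<Rightarrow> real" where
  "Q_proc v z = (fst z \<bullet> v)\<^sup>2"

definition V_proc ::
    "'w measure \<Rightarrow> ('w \<Rightarrow> (real ^ 'n) \<times> real) \<Rightarrow> real ^ 'n \<Rightarrow> real ^ 'n \<Rightarrow> real" where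
  "V_proc M Z w v = (\<integral>\<omega>. (snd (Z \<omega>) - fst (Z \<omega>) \<bullet> w) * (fst (Z \<omega>) \<bullet> v) \<partial>M)"

definition M_proc ::
    "'w measure \<Rightarrow> ('w \<Rightarrow> (real ^ 'n) \<times> real) \<Rightarrow> real ^ 'n \<Rightarrow> real ^ 'n \<Rightarrow> (real ^ 'n) \<times> real \<Rightarrow> real"
  where
  "M_proc M Z w v z = (snd z - fst z \<bullet> w) * (fst z \<bullet> v)
     - (\<integral>\<omega>. (snd (Z \<omega>) - fst (Z \<omega>) \<bullet> w) * (fst (Z \<omega>) \<bullet> v) \<partial>M)"

definition L_proc ::
    "'w measure \<Rightarrow> ('w \<Rightarrow> (real ^ 'n) \<times> real) \<Rightarrow> real ^ 'n \<Rightarrow> (real ^ 'n \<Rightarrow> real) \<Rightarrow> real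
      \<Rightarrow> real ^ 'n \<Rightarrow> (real ^ 'n) \<times> real \<Rightarrow> real" where
  "L_proc M Z w \<Psi> l v z =
     Q_proc v z - 2 * M_proc M Z w v z - 2 * V_proc M Z w v + l * (\<Psi> (w + v) - \<Psi> w)"

definition emp_avg :: "nat \<Rightarrow> (nat \<Rightarrow> 'w \<Rightarrow> 'z) \<Rightarrow> ('z \<Rightarrow> real) \<Rightarrow> 'w \<Rightarrow> real" where
  "emp_avg N Zs g \<omega> = (\<Sum>i<N. g (Zs i \<omega>)) / real N"

text \<open>
  Infima and suprema over \<open>\<theta>\<close> are taken in the extended reals; in particular the infimum over an
  empty set is \<open>\<infinity>\<close>. The outer infima are over nonempty sets of positive reals.
\<close>

definition r_Q ::
    "'w measure \<Rightarrow> nat \<Rightarrow> (nat \<Rightarrow> 'w \<Rightarrow> (real ^ 'n) \<times> real) \<Rightarrow> real ^ 'n \<Rightarrow> (real ^ 'n \<Rightarrow> real)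
      \<Rightarrow> real \<Rightarrow> real \<Rightarrow> real \<Rightarrow> real" where
  "r_Q M N Zs w \<Psi> \<Lambda> p \<rho> = Inf {r. 0 < r \<and>
     measure M {\<omega> \<in> space M.
       (INF \<theta>\<in>sphere w r \<inter> norm_ball \<Psi> w \<rho>. ereal (emp_avg N Zs (Q_proc (\<theta> - w)) \<omega>))
         \<ge> ereal (\<Lambda> * r\<^sup>2)} \<ge> 1 - p}"

definition r_V ::
    "'w measure \<Rightarrow> ('w \<Rightarrow> (real ^ 'n) \<times> real) \<Rightarrow> real ^ 'n \<Rightarrow> (real ^ 'n \<Rightarrow> real)
      \<Rightarrow> real \<Rightarrow> real \<Rightarrow> real" where
  "r_V M Z w \<Psi> \<Lambda> \<rho> = Inf {r. 0 < r \<and>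
     (SUP \<theta>\<in>cball w r \<inter> norm_ball \<Psi> w \<rho>. ereal \<bar>V_proc M Z w (\<theta> - w)\<bar>) \<le> ereal (\<Lambda> * r\<^sup>2)}"

definition r_M ::
    "'w measure \<Rightarrow> nat \<Rightarrow> ('w \<Rightarrow> (real ^ 'n) \<times> real) \<Rightarrow> (nat \<Rightarrow> 'w \<Rightarrow> (real ^ 'n) \<times> real)
      \<Rightarrow> real ^ 'n \<Rightarrow> (real ^ 'n \<Rightarrow> real) \<Rightarrow> real \<Rightarrow> real \<Rightarrow> real \<Rightarrow> real" where
  "r_M M N Z Zs w \<Psi> \<Lambda> p \<rho> = Inf {r. 0 < r \<and>
     measure M {\<omega> \<in> space M.
       (SUP \<theta>\<in>cball w r \<inter> norm_ball \<Psi> w \<rho>. ereal \<bar>emp_avg N Zs (M_proc M Z w (\<theta> - w)) \<omega>\<bar>)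
         \<le> ereal (\<Lambda> * r\<^sup>2)} \<ge> 1 - p}"

definition subgrad_set :: "(real ^ 'n \<Rightarrow> real) \<Rightarrow> real ^ 'n \<Rightarrow> real \<Rightarrow> (real ^ 'n) set" where
  "subgrad_set \<Psi> w \<rho> =
     {z. \<exists>u\<in>norm_ball \<Psi> w (\<rho> / 16). \<forall>h. \<Psi> (u + h) - \<Psi> u \<ge> z \<bullet> h}"

definition sparsity_gap :: "(real ^ 'n \<Rightarrow> real) \<Rightarrow> real ^ 'n \<Rightarrow> real \<Rightarrow> real \<Rightarrow> ereal" where
  "sparsity_gap \<Psi> w \<rho> r =
     (INF \<theta>\<in>cball w r \<inter> norm_sphere \<Psi> w \<rho>.
       SUP z\<in>subgrad_set \<Psi> w \<rho>. ereal (z \<bullet> (\<theta> - w)))"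

end

theory Submission
  imports Defs
begin

text \<open>
  Outside the localisation set the quadratic process beats the linear ones: a point \<open>v\<close> with
  \<open>\<Psi> v > \<rho>\<close> is scaled back to the \<open>\<Psi>\<close>-sphere of radius \<open>\<rho>\<close>, and by convexity of \<open>\<Psi>\<close> the loss grows at
  least linearly along the ray. If the scaled point is Euclidean-far, the lower bound on the quadratic
  process wins; if it is Euclidean-near, the penalty wins, since by the sparsity gap it increases by
  at least \<open>3/4 \<rho> - 2 \<rho>/16 = 5/8 \<rho>\<close>. The infima defining the radii need not be attained (on the sphere of
  radius exactly \<open>r\<close> the quadratic lower bound may fail), but by homogeneity the events increase with
  the radius, so a single event of the right probability works for all radii above the infimum, and
  this is all the argument uses.
\<close>

section \<open>Norms as real-valued functions\<close>

lemma is_normD: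
  assumes "is_norm \<Psi>"
  shows "0 \<le> \<Psi> u" "\<Psi> u = 0 \<longleftrightarrow> u = 0" "\<Psi> (c *\<^sub>R u) = \<bar>c\<bar> * \<Psi> u" "\<Psi> (u + v) \<le> \<Psi> u + \<Psi> v"
  using assms by (auto simp: is_norm_def)

lemma is_norm_minus: "is_norm \<Psi> \<Longrightarrow> \<Psi> (- u) = \<Psi> u"
  using is_normD(3)[of \<Psi> "-1" u] by simp

lemma is_norm_convex_on:
  assumes "is_norm \<Psi>"
  shows "convex_on UNIV \<Psi>"
proof (rule convex_onI)
  fix t u v assume "0 < (t::real)" "t < 1"
  then show "\<Psi> ((1 - t) *\<^sub>R u + t *\<^sub>R v) \<le> (1 - t) * \<Psi> u + t * \<Psi> v"
    using is_normD(4)[OF assms, of "(1 - t) *\<^sub>R u" "t *\<^sub>R v"] by (simp add: is_normD(3)[OF assms])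
qed simp

lemma is_norm_continuous:
  fixes \<Psi> :: "'a::euclidean_space \<Rightarrow> real"
  assumes "is_norm \<Psi>"
  shows "continuous_on UNIV \<Psi>"
  using convex_on_continuous[OF open_UNIV is_norm_convex_on[OF assms]] .

text \<open>The minimum of \<open>\<Psi>\<close> over the compact Euclidean unit sphere is positive,
  and homogeneity spreads it to all vectors. In particular \<open>\<Psi>\<close>-balls are Euclidean
  bounded.\<close>

lemma is_norm_lower_bound:
  fixes \<Psi> :: "'a::euclidean_space \<Rightarrow> real"
  assumes "is_norm \<Psi>"
  obtains c where "0 < c" "\<And>v. c * norm v \<le> \<Psi> v"
proof -
  have "continuous_on (sphere 0 1) \<Psi>"
    using is_norm_continuous[OF assms] continuous_on_subset by blast
  moreover have "(sphere 0 1 :: 'a set) \<noteq> {}" by simp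
  ultimately obtain a where a: "a \<in> sphere 0 1" "\<And>v. v \<in> sphere 0 1 \<Longrightarrow> \<Psi> a \<le> \<Psi> v"
    using continuous_attains_inf[OF compact_sphere] by blast
  have "a \<noteq> 0" using a by auto
  then have "0 < \<Psi> a"
    using is_normD(1,2)[OF assms, of a] by linarith
  moreover have "\<Psi> a * norm v \<le> \<Psi> v" for v
  proof (cases "v = 0")
    case True
    then show ?thesis by (simp add: is_normD(1)[OF assms])
  next
    case False
    then have "\<Psi> a \<le> \<Psi> ((1 / norm v) *\<^sub>R v)" by (intro a) simp
    with False show ?thesis by (simp add: is_normD(3)[OF assms] field_simps)
  qed
  ultimately show ?thesis using that by blast
qed

text \<open>Convexity: \<open>w + v\<close> lies on the segment from \<open>w\<close> to
  \<open>w + t *\<^sub>R v\<close> with weight \<open>1 / t\<close>, so slopes seen from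
  \<open>w\<close> do not decrease along the ray.\<close>

lemma norm_diff_scaleR_ge:
  assumes "is_norm \<Psi>" "1 \<le> t"
  shows "t * (\<Psi> (w + v) - \<Psi> w) \<le> \<Psi> (w + t *\<^sub>R v) - \<Psi> w"
proof -
  have "w + v = (1 - 1 / t) *\<^sub>R w + (1 / t) *\<^sub>R (w + t *\<^sub>R v)"
    using assms(2) by (simp add: algebra_simps)
  then have "\<Psi> (w + v) \<le> (1 - 1 / t) * \<Psi> w + (1 / t) * \<Psi> (w + t *\<^sub>R v)"
    using convex_onD[OF is_norm_convex_on[OF assms(1)], of "1 / t" w "w + t *\<^sub>R v"] assms(2)
    by auto
  then have "t * \<Psi> (w + v) \<le> t * ((1 - 1 / t) * \<Psi> w + (1 / t) * \<Psi> (w + t *\<^sub>R v))"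
    using assms(2) by (intro mult_left_mono) auto
  also have "\<dots> = (t - 1) * \<Psi> w + \<Psi> (w + t *\<^sub>R v)"
    using assms(2) by (simp add: field_simps)
  finally show ?thesis by (simp add: algebra_simps)
qed

section \<open>Transfer of homogeneous bounds to larger radii\<close>

text \<open>The factor \<open>s / t\<close> takes \<open>v\<close> into the ball of radius
  \<open>s\<close> and keeps it in the \<open>\<Psi>\<close>-ball. Undoing it gives the bound
  \<open>\<Lambda> * (s * t)\<close>, which is at most the claimed one.\<close>

lemma homogeneous_linear_bound_mono:
  fixes h :: "'a::real_normed_vector \<Rightarrow> real"
  assumes "is_norm \<Psi>" "\<And>c v. h (c *\<^sub>R v) = c * h v" "0 < s" "s \<le> t" "0 \<le> \<Lambda>"
    and "\<And>v. norm v \<le> s \<Longrightarrow> \<Psi> v \<le> \<rho> \<Longrightarrow> \<bar>h v\<bar> \<le> \<Lambda> * s\<^sup>2"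
    and "norm v \<le> t" "\<Psi> v \<le> \<rho>"
  shows "\<bar>h v\<bar> \<le> \<Lambda> * t\<^sup>2"
proof -
  have "\<bar>s / t\<bar> * \<Psi> v \<le> 1 * \<Psi> v"
    using assms(3,4) by (intro mult_right_mono is_normD(1)[OF assms(1)]) auto
  moreover have "(s / t) * norm v \<le> (s / t) * t" using assms by (intro mult_left_mono) auto
  ultimately have "\<bar>h ((s / t) *\<^sub>R v)\<bar> \<le> \<Lambda> * s\<^sup>2"
    using assms(3,4,7,8) by (intro assms(6)) (auto simp: is_normD(3)[OF assms(1)])
  then have "(s / t) * \<bar>h v\<bar> \<le> \<Lambda> * s\<^sup>2"
    using assms(3,4) by (simp add: assms(2) abs_mult)
  then have "\<bar>h v\<bar> \<le> \<Lambda> * (s * t)"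
    using assms(3,4) by (simp add: field_simps power2_eq_square)
  also have "\<dots> \<le> \<Lambda> * t\<^sup>2"
    using assms(3-5) by (intro mult_left_mono) (auto simp: power2_eq_square)
  finally show ?thesis .
qed

text \<open>The same contraction; both sides now scale by the square of \<open>s / t\<close>, so
  nothing is lost.\<close>

lemma homogeneous_quadratic_bound_mono:
  fixes Q :: "'a::real_normed_vector \<Rightarrow> real"
  assumes "is_norm \<Psi>" "\<And>c v. Q (c *\<^sub>R v) = c\<^sup>2 * Q v" "0 < s" "s \<le> t"
    and "\<And>v. norm v = s \<Longrightarrow> \<Psi> v \<le> \<rho> \<Longrightarrow> \<Lambda> * s\<^sup>2 \<le> Q v"
    and "norm v = t" "\<Psi> v \<le> \<rho>"
  shows "\<Lambda> * t\<^sup>2 \<le> Q v"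
proof -
  have "\<bar>s / t\<bar> * \<Psi> v \<le> 1 * \<Psi> v"
    using assms(3,4) by (intro mult_right_mono is_normD(1)[OF assms(1)]) auto
  then have "\<Lambda> * s\<^sup>2 \<le> Q ((s / t) *\<^sub>R v)"
    using assms(3,4,6,7) by (intro assms(5)) (auto simp: is_normD(3)[OF assms(1)])
  then show ?thesis
    using assms(3,4) by (simp add: assms(2) field_simps)
qed

section \<open>Penalty increments from subgradients\<close>

text \<open>\<open>z\<close> is a subgradient at a nearby \<open>u\<close>; moving the base point to
  \<open>w\<close> costs at most \<open>\<rho> / 16\<close> in each of the two values of
  \<open>\<Psi>\<close>.\<close>

lemma norm_increment_ge_of_subgradient:
  assumes "is_norm \<Psi>" "z \<in> subgrad_set \<Psi> w \<rho>"
  shows "z \<bullet> v - \<rho> / 8 \<le> \<Psi> (w + v) - \<Psi> w"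
proof -
  obtain u where u: "\<Psi> (u - w) \<le> \<rho> / 16" and z: "z \<bullet> v \<le> \<Psi> (u + v) - \<Psi> u"
    using assms(2) by (auto simp: subgrad_set_def norm_ball_def)
  have "\<Psi> (u + v) \<le> \<Psi> (u - w) + \<Psi> (w + v)"
    using is_normD(4)[OF assms(1), of "u - w" "w + v"] by simp
  moreover have "\<Psi> w \<le> \<Psi> (u - w) + \<Psi> u"
    using is_normD(4)[OF assms(1), of "w - u" u] is_norm_minus[OF assms(1), of "u - w"] by simp
  ultimately show ?thesis using u z by linarith
qed

lemma norm_increment_ge_of_sparsity_gap:
  assumes "is_norm \<Psi>" "ereal (3 / 4 * \<rho>) \<le> sparsity_gap \<Psi> w \<rho> r" "norm v \<le> r" "\<Psi> v = \<rho>"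
  shows "5 / 8 * \<rho> \<le> \<Psi> (w + v) - \<Psi> w"
proof -
  have "w + v \<in> cball w r \<inter> norm_sphere \<Psi> w \<rho>"
    using assms(3,4) by (simp add: norm_sphere_def dist_norm)
  then have "ereal (3 / 4 * \<rho>) \<le> (SUP z\<in>subgrad_set \<Psi> w \<rho>. ereal (z \<bullet> ((w + v) - w)))"
    using assms(2) unfolding sparsity_gap_def le_INF_iff by blast
  \<comment> \<open>The supremum may fail to be attained, so every \<open>z\<close> is bounded
    rather than a maximiser chosen.\<close>
  also have "\<dots> \<le> ereal (\<Psi> (w + v) - \<Psi> w + \<rho> / 8)"
    using norm_increment_ge_of_subgradient[OF assms(1), of _ w \<rho> v]
    by (intro SUP_least) (force simp: algebra_simps)
  finally show ?thesis by simp
qed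

section \<open>The deterministic estimate\<close>

text \<open>Meant for one fixed outcome: \<open>Q\<close> becomes the empirical quadratic process
  and \<open>h\<close> the empirical average of the uncentred product, that is, multiplier process
  plus bias, so \<open>\<Lambda>\<close> stands for the sum of their constants.\<close>

lemma regularized_loss_positive_outside:
  fixes \<Psi> :: "real ^ 'n \<Rightarrow> real"
  assumes norm: "is_norm \<Psi>" and rho: "0 < \<rho>" and r: "0 \<le> r"
    and Q_hom: "\<And>c v. Q (c *\<^sub>R v) = c\<^sup>2 * Q v" and Q_nonneg: "\<And>v. 0 \<le> Q v"
    and h_hom: "\<And>c v. h (c *\<^sub>R v) = c * h v"
    and Q_bound: "\<And>s v. r < s \<Longrightarrow> norm v = s \<Longrightarrow> \<Psi> v \<le> \<rho> \<Longrightarrow> \<Lambda>\<^sub>Q * s\<^sup>2 \<le> Q v"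
    and h_bound: "\<And>s v. r < s \<Longrightarrow> norm v \<le> s \<Longrightarrow> \<Psi> v \<le> \<rho> \<Longrightarrow> \<bar>h v\<bar> \<le> \<Lambda> * s\<^sup>2"
    and Lambdas: "0 < \<Lambda>\<^sub>Q" "0 < \<Lambda>"
    and lambda: "c\<^sub>2 * (r\<^sup>2 / \<rho>) \<le> l" "l \<le> c\<^sub>1 * (r\<^sup>2 / \<rho>)"
    and constants: "2 * \<Lambda> + c\<^sub>1 < \<Lambda>\<^sub>Q" "4 * \<Lambda> \<le> c\<^sub>2"
    and gap: "ereal (3 / 4 * \<rho>) \<le> sparsity_gap \<Psi> w \<rho> r"
    and v: "r < norm v \<or> \<rho> < \<Psi> v"
  shows "0 < Q v - 2 * h v + l * (\<Psi> (w + v) - \<Psi> w)"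
proof (cases "r = 0")
  case True
  \<comment> \<open>Here \<open>c\<^sub>1\<close> may be negative, so the first condition on the constants is useless; instead \<open>h = 0\<close>.\<close>
  have l: "l = 0" using lambda True by simp
  have "v \<noteq> 0" using v rho True is_normD(2)[OF norm, of 0] by auto
  then have Psi_v: "0 < \<Psi> v" and norm_v: "0 < norm v"
    using is_normD(1,2)[OF norm, of v] by (auto simp: less_le)
  \<comment> \<open>At scale \<open>t\<close> the ray through \<open>v\<close> meets the
    \<open>\<Psi>\<close>-sphere of radius \<open>\<rho>\<close>; up to there both bounds
    apply.\<close>
  define t where "t = \<rho> / \<Psi> v"
  have t: "0 < t" using rho Psi_v by (simp add: t_def)
  have small: "\<Psi> (s *\<^sub>R v) \<le> \<rho>" if "0 < s" "s \<le> t" for s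
    using that Psi_v by (simp add: t_def is_normD(3)[OF norm] field_simps)
  \<comment> \<open>\<open>h\<close> scales linearly in \<open>s\<close> but its bound
    quadratically; dividing by \<open>s\<close> and letting \<open>s\<close> tend to 0 forces
    \<open>h v = 0\<close>.\<close>
  have "\<bar>h v\<bar> \<le> s * (\<Lambda> * (norm v)\<^sup>2)" if "0 < s" "s \<le> t" for s
  proof -
    have "\<bar>h (s *\<^sub>R v)\<bar> \<le> \<Lambda> * (s * norm v)\<^sup>2"
      using that norm_v True by (intro h_bound small) auto
    then have "s * \<bar>h v\<bar> \<le> s * (s * (\<Lambda> * (norm v)\<^sup>2))"
      using that by (simp add: h_hom abs_mult power2_eq_square algebra_simps)
    then show ?thesis using that by simp
  qed
  then have ev: "\<forall>\<^sub>F s in at_right 0. \<bar>h v\<bar> \<le> s * (\<Lambda> * (norm v)\<^sup>2)"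
    using t unfolding eventually_at_right_field by (intro exI[of _ t]) auto
  have "((\<lambda>s. s * (\<Lambda> * (norm v)\<^sup>2)) \<longlongrightarrow> 0 * (\<Lambda> * (norm v)\<^sup>2)) (at_right 0)"
    by (intro tendsto_intros)
  then have "\<bar>h v\<bar> \<le> 0 * (\<Lambda> * (norm v)\<^sup>2)"
    using ev by (rule tendsto_lowerbound) simp
  then have "h v = 0" by simp
  moreover have "0 < Q v"
  proof -
    have "\<Lambda>\<^sub>Q * (t * norm v)\<^sup>2 \<le> Q (t *\<^sub>R v)"
      using t norm_v True by (intro Q_bound small) auto
    then have "t\<^sup>2 * (\<Lambda>\<^sub>Q * (norm v)\<^sup>2) \<le> t\<^sup>2 * Q v"
      by (simp add: Q_hom power_mult_distrib mult_ac)
    then have "\<Lambda>\<^sub>Q * (norm v)\<^sup>2 \<le> Q v" using t by simp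
    moreover have "0 < \<Lambda>\<^sub>Q * (norm v)\<^sup>2" using Lambdas norm_v by simp
    ultimately show ?thesis by linarith
  qed
  ultimately show ?thesis using l by simp
next
  case False
  define L where "L u = Q u - 2 * h u + l * (\<Psi> (w + u) - \<Psi> w)" for u
  have r2: "0 < r\<^sup>2" using False by simp
  \<comment> \<open>The sign of \<open>c\<^sub>1\<close> is derived: \<open>c\<^sub>2\<close> is
    positive, hence so is \<open>l\<close>, and the upper bound on \<open>l\<close> passes this on
    to \<open>c\<^sub>1\<close>.\<close>
  have c2: "0 < c\<^sub>2" using constants Lambdas by linarith
  then have "0 < c\<^sub>2 * (r\<^sup>2 / \<rho>)" using r2 rho by simp
  then have l: "0 < l" using lambda by linarith
  then have "0 < c\<^sub>1 * (r\<^sup>2 / \<rho>)" using lambda by linarith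
  then have c1: "0 < c\<^sub>1" using r2 rho by (simp add: zero_less_mult_iff zero_less_divide_iff)
  have l_le: "l * \<rho> \<le> c\<^sub>1 * r\<^sup>2" and l_ge: "c\<^sub>2 * r\<^sup>2 \<le> l * \<rho>"
    using lambda rho by (simp_all add: field_simps)
  \<comment> \<open>The penalty drops by at most \<open>l * \<rho>\<close>, hence by at most
    \<open>c\<^sub>1 * (norm u)\<^sup>2\<close>; the strict inequality between the constants leaves
    a positive multiple of \<open>(norm u)\<^sup>2\<close>.\<close>
  have far: "0 < L u" if "r < norm u" "\<Psi> u \<le> \<rho>" for u
  proof -
    have "\<Lambda>\<^sub>Q * (norm u)\<^sup>2 \<le> Q u" "\<bar>h u\<bar> \<le> \<Lambda> * (norm u)\<^sup>2"
      using that by (auto intro: Q_bound h_bound)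
    moreover have "\<Psi> w - \<Psi> (w + u) \<le> \<rho>"
      using that is_normD(4)[OF norm, of "w + u" "- u"] is_norm_minus[OF norm, of u] by simp
    then have "l * (\<Psi> w - \<Psi> (w + u)) \<le> l * \<rho>" using l by simp
    moreover have "c\<^sub>1 * r\<^sup>2 \<le> c\<^sub>1 * (norm u)\<^sup>2"
      using c1 that r by (intro mult_left_mono power_mono) auto
    moreover have "0 < (\<Lambda>\<^sub>Q - 2 * \<Lambda> - c\<^sub>1) * (norm u)\<^sup>2"
      using constants that r by (intro mult_pos_pos) auto
    ultimately show ?thesis
      using l_le by (simp add: L_def algebra_simps abs_le_iff)
  qed
  \<comment> \<open>Letting \<open>s\<close> decrease to \<open>r\<close> bounds
    \<open>2 * h u\<close> by \<open>2 * \<Lambda> * r\<^sup>2\<close>. The penalty gains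
    \<open>5 / 8 * l * \<rho>\<close>, which \<open>4 * \<Lambda> \<le> c\<^sub>2\<close> makes at
    least \<open>5 / 2 * \<Lambda> * r\<^sup>2\<close>.\<close>
  have near: "0 < L u" if "norm u \<le> r" "\<Psi> u = \<rho>" for u
  proof -
    have "\<bar>h u\<bar> \<le> \<Lambda> * r\<^sup>2"
    proof -
      have "\<forall>\<^sub>F s in at_right r. \<bar>h u\<bar> \<le> \<Lambda> * s\<^sup>2"
        using that by (intro eventually_mono[OF eventually_at_right_less] h_bound) auto
      moreover have "((\<lambda>s. \<Lambda> * s\<^sup>2) \<longlongrightarrow> \<Lambda> * r\<^sup>2) (at_right r)"
        by (intro tendsto_intros)
      ultimately show ?thesis
        using tendsto_lowerbound[of _ "\<Lambda> * r\<^sup>2" "at_right r" "\<bar>h u\<bar>"] by simp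
    qed
    moreover have "l * (5 / 8 * \<rho>) \<le> l * (\<Psi> (w + u) - \<Psi> w)"
      using norm_increment_ge_of_sparsity_gap[OF norm gap that] l by (intro mult_left_mono) auto
    moreover have "4 * \<Lambda> * r\<^sup>2 \<le> c\<^sub>2 * r\<^sup>2" using constants by (intro mult_right_mono) auto
    moreover have "0 < \<Lambda> * r\<^sup>2" using Lambdas r2 by simp
    ultimately show ?thesis
      using l_ge Q_nonneg[of u] by (simp add: L_def abs_le_iff)
  qed
  have "0 < L v"
  proof (cases "\<Psi> v \<le> \<rho>")
    case True
    then show ?thesis using v far by auto
  next
    case False
    define t where "t = \<Psi> v / \<rho>"
    define u where "u = (1 / t) *\<^sub>R v"
    have t: "1 < t" using False rho by (simp add: t_def)
    have v_eq: "v = t *\<^sub>R u" using t by (simp add: u_def)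
    have "\<Psi> u = \<rho>" using t False rho by (simp add: u_def is_normD(3)[OF norm] t_def)
    then have "0 < t * L u" using t far[of u] near[of u] by (cases "r < norm u") auto
    \<comment> \<open>From \<open>u\<close> to \<open>v\<close> the linear term scales by
      \<open>t\<close>, the quadratic one by \<open>t\<^sup>2\<close>, and the penalty increment by
      at least \<open>t\<close>.\<close>
    also have "t * L u \<le> L v"
    proof -
      have "t * Q u \<le> t\<^sup>2 * Q u"
        using t Q_nonneg[of u] by (intro mult_right_mono) (auto simp: power2_eq_square)
      moreover have "l * (t * (\<Psi> (w + u) - \<Psi> w)) \<le> l * (\<Psi> (w + v) - \<Psi> w)"
        unfolding v_eq using t l by (intro mult_left_mono norm_diff_scaleR_ge[OF norm]) auto
      ultimately show ?thesis
        unfolding L_def by (simp add: v_eq Q_hom h_hom algebra_simps)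
    qed
    finally show ?thesis .
  qed
  then show ?thesis by (simp add: L_def)
qed

section \<open>One event for all radii above a threshold\<close>

text \<open>Radii in \<open>R\<close> are chosen that approach \<open>Inf R\<close>. By monotonicity
  a finite intersection of their events is the event of the smallest radius, so it keeps the
  probability bound, and continuity from above carries the bound to the countable
  intersection.\<close>

lemma (in prob_space) exists_event_of_Inf_threshold:
  fixes E :: "real \<Rightarrow> 'a set" and p :: real
  defines "R \<equiv> {s. 0 < s \<and> measure M (E s) \<ge> 1 - p}"
  assumes mono: "\<And>s t. 0 < s \<Longrightarrow> s \<le> t \<Longrightarrow> E s \<subseteq> E t"
    and p: "p < 1" and nonempty: "R \<noteq> {}"
  shows "\<exists>A\<in>events. prob A \<ge> 1 - p \<and> (\<forall>s>Inf R. A \<subseteq> E s)"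
proof -
  have bdd: "bdd_below R" by (auto simp: R_def intro!: bdd_belowI[of _ 0])
  have "\<exists>s\<in>R. s < Inf R + 1 / Suc k" for k
    using cInf_less_iff[OF nonempty bdd, of "Inf R + 1 / Suc k"] by auto
  then obtain s where s: "\<And>k. s k \<in> R" "\<And>k. s k < Inf R + 1 / Suc k" by metis
  have pos: "0 < s k" for k using s(1)[of k] by (simp add: R_def)
  \<comment> \<open>Non-measurable sets have measure 0.\<close>
  have meas: "E (s k) \<in> events" for k
    using s(1)[of k] p by (auto simp: R_def measure_notin_sets intro: ccontr)
  define B where "B k = (\<Inter>i\<le>k. E (s i))" for k
  have B_events: "B k \<in> events" for k
    unfolding B_def using meas by (intro sets.finite_INT) auto
  have B_prob: "prob (B k) \<ge> 1 - p" for k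
  proof -
    obtain j where j: "j \<le> k" "\<And>i. i \<le> k \<Longrightarrow> s j \<le> s i"
      using ex_min_if_finite[of "s ` {..k}"] by (fastforce simp: not_less)
    then have "B k = E (s j)"
      unfolding B_def using mono[OF pos, of j "s _"] by blast
    then show ?thesis using s(1)[of j] by (simp add: R_def)
  qed
  have "decseq B" by (auto simp: decseq_def B_def)
  then have "(\<lambda>k. prob (B k)) \<longlonglongrightarrow> prob (\<Inter>k. B k)"
    using B_events by (intro finite_Lim_measure_decseq) auto
  then have "prob (\<Inter>k. B k) \<ge> 1 - p"
    using B_prob by (intro LIMSEQ_le_const) auto
  moreover have "(\<Inter>k. B k) \<in> events" using B_events by auto
  moreover have "(\<Inter>k. B k) \<subseteq> E t" if "Inf R < t" for t
  proof -
    have "0 < t - Inf R" using that by simp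
    then obtain k where "1 / Suc k < t - Inf R" by (rule nat_approx_posE)
    then have "s k \<le> t" using s(2)[of k] by linarith
    then have "E (s k) \<subseteq> E t" using mono pos by blast
    moreover have "B k \<subseteq> E (s k)" by (auto simp: B_def)
    ultimately show ?thesis by blast
  qed
  ultimately show ?thesis by blast
qed

section \<open>Measurability of positivity over uncountable families\<close>

text \<open>On a compact set positivity of a continuous function amounts to a uniform lower bound
  \<open>1 / Suc k\<close>. This closed condition can be tested on a countable dense subset.\<close>

lemma sets_Ball_pos_compact:
  fixes F :: "'b::{metric_space, second_countable_topology} \<Rightarrow> 'a \<Rightarrow> real"
  assumes C: "compact C"
    and cont: "\<And>\<omega>. \<omega> \<in> space M \<Longrightarrow> continuous_on C (\<lambda>\<theta>. F \<theta> \<omega>)"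
    and meas [measurable]: "\<And>\<theta>. F \<theta> \<in> borel_measurable M"
  shows "{\<omega> \<in> space M. \<forall>\<theta>\<in>C. 0 < F \<theta> \<omega>} \<in> sets M"
proof -
  obtain D where D: "countable D" "D \<subseteq> C" "C \<subseteq> closure D"
    using separable by blast
  have "(\<forall>\<theta>\<in>C. 0 < F \<theta> \<omega>) \<longleftrightarrow> (\<exists>k. \<forall>\<theta>\<in>D. 1 / Suc k \<le> F \<theta> \<omega>)"
    if \<omega>: "\<omega> \<in> space M" for \<omega>
  proof
    assume pos: "\<forall>\<theta>\<in>C. 0 < F \<theta> \<omega>"
    show "\<exists>k. \<forall>\<theta>\<in>D. 1 / Suc k \<le> F \<theta> \<omega>"
    proof (cases "C = {}")
      case True
      then show ?thesis using D by auto
    next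
      case False
      then obtain a where a: "a \<in> C" "\<And>\<theta>. \<theta> \<in> C \<Longrightarrow> F a \<omega> \<le> F \<theta> \<omega>"
        using continuous_attains_inf[OF C _ cont[OF \<omega>]] by blast
      obtain k where "1 / Suc k < F a \<omega>"
        using nat_approx_posE[of "F a \<omega>"] pos a by blast
      then show ?thesis using a D(2) by (meson less_le_trans less_imp_le subsetD)
    qed
  next
    assume "\<exists>k. \<forall>\<theta>\<in>D. 1 / Suc k \<le> F \<theta> \<omega>"
    then obtain k where k: "\<And>\<theta>. \<theta> \<in> D \<Longrightarrow> 1 / Suc k \<le> F \<theta> \<omega>" by blast
    have "closedin (top_of_set C) {\<theta> \<in> C. F \<theta> \<omega> \<in> {1 / Suc k..}}"
      using continuous_closedin_preimage[OF cont[OF \<omega>] closed_atLeast, of "1 / Suc k"]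
      by (simp add: vimage_def Int_def)
    then have "closed {\<theta> \<in> C. F \<theta> \<omega> \<in> {1 / Suc k..}}"
      using closedin_closed_trans compact_imp_closed[OF C] by blast
    then have "closure D \<subseteq> {\<theta> \<in> C. F \<theta> \<omega> \<in> {1 / Suc k..}}"
      using k D(2) by (intro closure_minimal) auto
    then have "1 / Suc k \<le> F \<theta> \<omega>" if "\<theta> \<in> C" for \<theta> using D(3) that by auto
    moreover have "0 < 1 / real (Suc k)" by simp
    ultimately show "\<forall>\<theta>\<in>C. 0 < F \<theta> \<omega>" by (meson less_le_trans)
  qed
  then have "{\<omega> \<in> space M. \<forall>\<theta>\<in>C. 0 < F \<theta> \<omega>}
      = {\<omega> \<in> space M. \<exists>k. \<forall>\<theta>\<in>D. 1 / Suc k \<le> F \<theta> \<omega>}" by blast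
  also have "\<dots> \<in> sets M" using D(1) by measurable
  finally show ?thesis .
qed

text \<open>An open set is a countable union of compact sets. It will be the complement of the
  localisation set.\<close>

lemma sets_Ball_pos_open:
  fixes F :: "'b::euclidean_space \<Rightarrow> 'a \<Rightarrow> real"
  assumes U: "open U"
    and cont: "\<And>\<omega>. \<omega> \<in> space M \<Longrightarrow> continuous_on U (\<lambda>\<theta>. F \<theta> \<omega>)"
    and meas: "\<And>\<theta>. F \<theta> \<in> borel_measurable M"
  shows "{\<omega> \<in> space M. \<forall>\<theta>\<in>U. 0 < F \<theta> \<omega>} \<in> sets M"
proof -
  obtain C :: "nat \<Rightarrow> 'b set" where C: "\<And>k. compact (C k)" "\<And>k. C k \<subseteq> U" "(\<Union>k. C k) = U"
    using open_Union_compact_subsets[OF U] by metis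
  have "{\<omega> \<in> space M. \<forall>\<theta>\<in>U. 0 < F \<theta> \<omega>} = (\<Inter>k. {\<omega> \<in> space M. \<forall>\<theta>\<in>C k. 0 < F \<theta> \<omega>})"
    using C(3) by blast
  also have "\<dots> \<in> sets M"
    using C(1) continuous_on_subset[OF cont C(2)] meas
    by (intro sets.countable_INT) (auto intro!: sets_Ball_pos_compact)
  finally show ?thesis .
qed

section \<open>Measurability and boundedness of the truncations\<close>

lemma abs_trunc_real_le: "0 \<le> \<tau> \<Longrightarrow> \<bar>trunc_real \<tau> a\<bar> \<le> \<tau>"
  by (simp add: trunc_real_def abs_mult abs_sgn_eq)

lemma trunc_real_measurable [measurable]: "trunc_real \<tau> \<in> borel_measurable borel"
  unfolding trunc_real_def[abs_def] by measurable

lemma norm_trunc_coord_le: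
  fixes u :: "real ^ 'n"
  assumes "0 \<le> \<tau>"
  shows "norm (trunc_coord \<tau> u) \<le> real CARD('n) * \<tau>"
proof -
  have "norm (trunc_coord \<tau> u) \<le> (\<Sum>j\<in>UNIV. \<bar>trunc_coord \<tau> u $ j\<bar>)"
    by (rule norm_le_l1_cart)
  also have "\<dots> \<le> (\<Sum>j\<in>(UNIV :: 'n set). \<tau>)"
    by (intro sum_mono) (simp add: trunc_coord_def abs_trunc_real_le[OF assms])
  finally show ?thesis by simp
qed

lemma trunc_coord_measurable [measurable]:
  "(trunc_coord \<tau> :: real ^ 'n \<Rightarrow> real ^ 'n) \<in> borel_measurable borel"
  unfolding borel_measurable_euclidean_space[of "trunc_coord \<tau>"]
  by (auto simp: Basis_vec_def inner_axis trunc_coord_def)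

lemma norm_trunc_radial_le:
  fixes u :: "real ^ 'n"
  assumes "0 \<le> \<tau>"
  shows "norm (trunc_radial \<tau> u) \<le> sqrt (real CARD('n)) * \<tau>"
proof -
  have "norm (trunc_radial \<tau> u) \<le> min (norm u / sqrt (real CARD('n))) \<tau> * sqrt (real CARD('n))"
    using assms by (simp add: trunc_radial_def)
  also have "\<dots> \<le> \<tau> * sqrt (real CARD('n))" by (intro mult_right_mono) auto
  finally show ?thesis by (simp add: mult.commute)
qed

lemma trunc_radial_measurable [measurable]: "trunc_radial \<tau> \<in> borel_measurable borel"
  unfolding trunc_radial_def[abs_def] by measurable

lemma admissible_truncation_measurable:
  fixes T :: "(real ^ 'n) \<times> real \<Rightarrow> (real ^ 'n) \<times> real"
  assumes "admissible_truncation N q T"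
  shows "T \<in> borel_measurable borel"
proof -
  have "(\<lambda>(u, a). (g u, trunc_real \<tau> a)) \<in> borel_measurable borel"
    if [measurable]: "g \<in> borel_measurable borel" for g :: "real ^ 'n \<Rightarrow> real ^ 'n" and \<tau>
    unfolding case_prod_beta' borel_prod[symmetric] by measurable
  then show ?thesis
    using assms by (auto simp: admissible_truncation_def Let_def)
qed

text \<open>Bounded data bound the linear processes by a multiple of \<open>norm v\<close>, which
  makes the sets of radii behind \<open>r_M\<close> and \<open>r_V\<close> nonempty.\<close>

lemma admissible_truncation_bounded:
  fixes T :: "(real ^ 'n) \<times> real \<Rightarrow> (real ^ 'n) \<times> real"
  assumes "admissible_truncation N q T"
  obtains B where "\<And>z. norm (fst (T z)) \<le> B" "\<And>z. \<bar>snd (T z)\<bar> \<le> B"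
proof -
  note bound = that
  have *: thesis if T: "T = (\<lambda>(u, a). (g u, trunc_real \<tau> a))" and \<tau>: "0 \<le> \<tau>"
    and g: "\<And>u. norm (g u) \<le> c * \<tau>" for g \<tau> c
  proof (rule bound[of "max (c * \<tau>) \<tau>"])
    show "norm (fst (T z)) \<le> max (c * \<tau>) \<tau>" for z
      using g[of "fst z"] by (simp add: T case_prod_beta)
    show "\<bar>snd (T z)\<bar> \<le> max (c * \<tau>) \<tau>" for z
      using abs_trunc_real_le[OF \<tau>, of "snd z"] by (simp add: T case_prod_beta)
  qed
  show thesis
    using assms unfolding admissible_truncation_def Let_def
  proof
    assume T: "T = (\<lambda>(u, a). (trunc_coord ((real N / ln (exp 1 * real CARD('n))) powr (1 / 4)) u,
      trunc_real ((real N / ln (exp 1 * real CARD('n))) powr (1 / 4)) a))"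
    show thesis by (rule *[OF T, where c = "real CARD('n)"]) (simp_all add: norm_trunc_coord_le)
  next
    assume T: "T = (\<lambda>(u, a). (trunc_radial (real N powr (2 / (q + 4))) u,
      trunc_real (real N powr (2 / (q + 4))) a))"
    show thesis by (rule *[OF T, where c = "sqrt (real CARD('n))"]) (simp_all add: norm_trunc_radial_le)
  qed
qed

section \<open>Homogeneity and empirical averages of the processes\<close>

lemma emp_avg_Q_proc_scaleR:
  "emp_avg N Zs (Q_proc (c *\<^sub>R v)) \<omega> = c\<^sup>2 * emp_avg N Zs (Q_proc v) \<omega>"
  by (simp add: emp_avg_def Q_proc_def power_mult_distrib sum_distrib_left)

lemma emp_avg_Q_proc_nonneg: "0 \<le> emp_avg N Zs (Q_proc v) \<omega>"
  by (simp add: emp_avg_def Q_proc_def sum_nonneg)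

lemma V_proc_scaleR: "V_proc M Z w (c *\<^sub>R v) = c * V_proc M Z w v"
  by (simp add: V_proc_def mult.left_commute)

lemma M_proc_scaleR: "M_proc M Z w (c *\<^sub>R v) z = c * M_proc M Z w v z"
  unfolding M_proc_def V_proc_def[symmetric] V_proc_scaleR by (simp add: algebra_simps)

lemma emp_avg_M_proc_scaleR:
  "emp_avg N Zs (M_proc M Z w (c *\<^sub>R v)) \<omega> = c * emp_avg N Zs (M_proc M Z w v) \<omega>"
  by (simp add: emp_avg_def M_proc_scaleR sum_distrib_left)

lemma emp_avg_M_proc:
  assumes "0 < N"
  shows "emp_avg N Zs (M_proc M Z w v) \<omega> =
    emp_avg N Zs (\<lambda>z. (snd z - fst z \<bullet> w) * (fst z \<bullet> v)) \<omega> - V_proc M Z w v"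
  using assms by (simp add: emp_avg_def M_proc_def V_proc_def sum_subtractf diff_divide_distrib)

text \<open>The centring inside \<open>M_proc\<close> cancels against the \<open>V_proc\<close>
  term, leaving the uncentred product.\<close>

lemma emp_avg_L_proc:
  assumes "0 < N"
  shows "emp_avg N Zs (L_proc M Z w \<Psi> l v) \<omega> =
    emp_avg N Zs (Q_proc v) \<omega>
      - 2 * emp_avg N Zs (\<lambda>z. (snd z - fst z \<bullet> w) * (fst z \<bullet> v)) \<omega> + l * (\<Psi> (w + v) - \<Psi> w)"
  using assms
  by (simp add: emp_avg_def L_proc_def M_proc_def V_proc_def[symmetric] sum_subtractf sum.distrib sum_distrib_left[symmetric]
      add_divide_distrib diff_divide_distrib)

lemma abs_emp_avg_le:
  assumes "0 < N" "\<And>i. i < N \<Longrightarrow> \<bar>g (Zs i \<omega>)\<bar> \<le> K"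
  shows "\<bar>emp_avg N Zs g \<omega>\<bar> \<le> K"
proof -
  have "\<bar>\<Sum>i<N. g (Zs i \<omega>)\<bar> \<le> (\<Sum>i<N. K)"
    using assms(2) by (intro order_trans[OF sum_abs] sum_mono) auto
  then show ?thesis using assms(1) by (simp add: emp_avg_def field_simps)
qed

section \<open>The radii in terms of displacements from the target\<close>

lemma sphere_Int_norm_ball:
  "sphere w s \<inter> norm_ball \<Psi> w \<rho> = (+) w ` {v. norm v = s \<and> \<Psi> v \<le> \<rho>}"
  by (force simp: norm_ball_def dist_norm norm_minus_commute image_iff)

lemma cball_Int_norm_ball:
  "cball w s \<inter> norm_ball \<Psi> w \<rho> = (+) w ` {v. norm v \<le> s \<and> \<Psi> v \<le> \<rho>}"
  by (force simp: norm_ball_def dist_norm norm_minus_commute image_iff)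

text \<open>A lower bound on an infimum is a universal statement, so the extended reals disappear;
  the infinite infimum over an empty set becomes vacuous truth.\<close>

lemma r_Q_eq:
  "r_Q M N Zs w \<Psi> \<Lambda> p \<rho> = Inf {s. 0 < s \<and> measure M {\<omega> \<in> space M.
     \<forall>v. norm v = s \<and> \<Psi> v \<le> \<rho> \<longrightarrow> \<Lambda> * s\<^sup>2 \<le> emp_avg N Zs (Q_proc v) \<omega>} \<ge> 1 - p}"
  by (simp add: r_Q_def sphere_Int_norm_ball le_INF_iff)

lemma r_M_eq:
  "r_M M N Z Zs w \<Psi> \<Lambda> p \<rho> = Inf {s. 0 < s \<and> measure M {\<omega> \<in> space M.
     \<forall>v. norm v \<le> s \<and> \<Psi> v \<le> \<rho> \<longrightarrow> \<bar>emp_avg N Zs (M_proc M Z w v) \<omega>\<bar> \<le> \<Lambda> * s\<^sup>2} \<ge> 1 - p}"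
  by (simp add: r_M_def cball_Int_norm_ball SUP_le_iff)

lemma r_V_eq:
  "r_V M Z w \<Psi> \<Lambda> \<rho> = Inf {s. 0 < s \<and>
     (\<forall>v. norm v \<le> s \<and> \<Psi> v \<le> \<rho> \<longrightarrow> \<bar>V_proc M Z w v\<bar> \<le> \<Lambda> * s\<^sup>2)}"
  by (simp add: r_V_def cball_Int_norm_ball SUP_le_iff)

section \<open>From the deterministic estimate to the probability bound\<close>

theorem theorem3p1:
  fixes M :: "'w measure" and x :: "'w \<Rightarrow> real ^ 'n" and y \<xi> :: "'w \<Rightarrow> real"
    and f :: "real \<Rightarrow> real \<Rightarrow> real" and \<theta>\<^sub>0 :: "real ^ 'n" and q \<nu> \<nu>\<^sub>q \<kappa> :: real
    and N :: nat and X :: "nat \<Rightarrow> 'w \<Rightarrow> real ^ 'n" and Y :: "nat \<Rightarrow> 'w \<Rightarrow> real"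
    and \<Psi> :: "real ^ 'n \<Rightarrow> real"
    and T :: "(real ^ 'n) \<times> real \<Rightarrow> (real ^ 'n) \<times> real"
    and Z :: "'w \<Rightarrow> (real ^ 'n) \<times> real" and Zs :: "nat \<Rightarrow> 'w \<Rightarrow> (real ^ 'n) \<times> real"
    and \<eta> :: real and w :: "real ^ 'n"
    and \<Lambda>\<^sub>Q \<Lambda>\<^sub>M \<Lambda>\<^sub>V \<rho> p\<^sub>Q p\<^sub>M r l c\<^sub>1 c\<^sub>2 :: real
  assumes model: "single_index_sample M x y \<xi> f \<theta>\<^sub>0 q \<nu> \<nu>\<^sub>q \<kappa> N X Y"
    and norm: "is_norm \<Psi>"
    and trunc: "admissible_truncation N q T"
    and Z: "Z = (\<lambda>\<omega>. T (x \<omega>, y \<omega>))"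
    and Zs: "Zs = (\<lambda>i \<omega>. T (X i \<omega>, Y i \<omega>))"
    and eta: "\<eta> = scale_factor M x y \<theta>\<^sub>0" "\<eta> \<noteq> 0"
    and w: "w = \<eta> *\<^sub>R \<theta>\<^sub>0"
    and Lambdas: "0 < \<Lambda>\<^sub>Q" "0 < \<Lambda>\<^sub>M" "0 < \<Lambda>\<^sub>V"
    and rho: "0 < \<rho>"
    and probs: "p\<^sub>Q \<in> {0<..<1}" "p\<^sub>M \<in> {0<..<1}"
    and r: "r = Max {r_Q M N Zs w \<Psi> \<Lambda>\<^sub>Q p\<^sub>Q \<rho>, r_M M N Z Zs w \<Psi> \<Lambda>\<^sub>M p\<^sub>M \<rho>, r_V M Z w \<Psi> \<Lambda>\<^sub>V \<rho>}"
    and lambda: "c\<^sub>2 * (r\<^sup>2 / \<rho>) \<le> l" "l \<le> c\<^sub>1 * (r\<^sup>2 / \<rho>)"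
    and constants: "\<Lambda>\<^sub>Q > 2 * (\<Lambda>\<^sub>M + \<Lambda>\<^sub>V) + c\<^sub>1" "c\<^sub>2 \<ge> 4 * (\<Lambda>\<^sub>M + \<Lambda>\<^sub>V)"
    and gap: "sparsity_gap \<Psi> w \<rho> r \<ge> ereal (3 / 4 * \<rho>)"
  shows "measure M {\<omega> \<in> space M.
           \<forall>\<theta>. \<theta> \<notin> cball w r \<inter> norm_ball \<Psi> w \<rho> \<longrightarrow>
             emp_avg N Zs (L_proc M Z w \<Psi> l (\<theta> - w)) \<omega> > 0}
         \<ge> 1 - p\<^sub>Q - p\<^sub>M"
proof -
  interpret single_index_sample M x y \<xi> f \<theta>\<^sub>0 q \<nu> \<nu>\<^sub>q \<kappa> N X Y by (rule model)
  note N = sample_size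
  have T_meas [measurable]: "T \<in> borel_measurable borel"
    by (rule admissible_truncation_measurable[OF trunc])
  have Zs_meas: "Zs i \<in> borel_measurable M" if "i < N" for i
  proof -
    have "(\<lambda>\<omega>. (X i \<omega>, Y i \<omega>)) \<in> borel_measurable M"
      using sample_indep that by (simp add: indep_vars_def)
    then show ?thesis unfolding Zs by measurable
  qed
  let ?G = "\<lambda>v z. (snd z - fst z \<bullet> w) * (fst z \<bullet> v)"
  obtain B where B: "\<And>z. norm (fst (T z)) \<le> B" "\<And>z. \<bar>snd (T z)\<bar> \<le> B"
    using admissible_truncation_bounded[OF trunc] by blast
  have B0: "0 \<le> B" using B(2)[of undefined] by linarith
  \<comment> \<open>Cauchy-Schwarz: the residual is at most \<open>B + B * norm w\<close>, the other
    factor at most \<open>B * norm v\<close>.\<close>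
  define K where "K = (B + B * norm w) * B"
  have K0: "0 \<le> K" using B0 by (simp add: K_def)
  have G_le: "\<bar>?G v (T z)\<bar> \<le> K * norm v" for v z
  proof -
    have "\<bar>fst (T z) \<bullet> w\<bar> \<le> B * norm w" "\<bar>fst (T z) \<bullet> v\<bar> \<le> B * norm v"
      using B(1)[of z] by (meson Cauchy_Schwarz_ineq2 mult_right_mono norm_ge_zero order_trans)+
    then have "\<bar>?G v (T z)\<bar> \<le> (B + B * norm w) * (B * norm v)"
      unfolding abs_mult using B(2)[of z] B0 by (intro mult_mono) auto
    then show ?thesis by (simp add: K_def mult.assoc)
  qed
  have V_le: "\<bar>V_proc M Z w v\<bar> \<le> K * norm v" for v
  \<comment> \<open>A non-integrable integrand has integral 0 by convention, for which the bound is
    trivial.\<close>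
  proof (cases "integrable M (\<lambda>\<omega>. ?G v (Z \<omega>))")
    case True
    have "\<bar>V_proc M Z w v\<bar> \<le> (\<integral>\<omega>. \<bar>?G v (Z \<omega>)\<bar> \<partial>M)"
      unfolding V_proc_def by (rule integral_abs_bound)
    also have "\<dots> \<le> K * norm v"
      using True G_le by (intro integral_le_const) (auto simp: Z)
    finally show ?thesis .
  next
    case False
    then show ?thesis using K0 by (simp add: V_proc_def not_integrable_integral_eq)
  qed
  have M_le: "\<bar>emp_avg N Zs (M_proc M Z w v) \<omega>\<bar> \<le> 2 * K * norm v" for v \<omega>
  proof -
    have "\<bar>emp_avg N Zs (?G v) \<omega>\<bar> \<le> K * norm v"
      using G_le by (intro abs_emp_avg_le N) (simp add: Zs)
    then show ?thesis unfolding emp_avg_M_proc[OF N] using V_le[of v] by linarith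
  qed

  define E_Q where "E_Q s = {\<omega> \<in> space M.
     \<forall>v. norm v = s \<and> \<Psi> v \<le> \<rho> \<longrightarrow> \<Lambda>\<^sub>Q * s\<^sup>2 \<le> emp_avg N Zs (Q_proc v) \<omega>}" for s
  define E_M where "E_M s = {\<omega> \<in> space M.
     \<forall>v. norm v \<le> s \<and> \<Psi> v \<le> \<rho> \<longrightarrow> \<bar>emp_avg N Zs (M_proc M Z w v) \<omega>\<bar> \<le> \<Lambda>\<^sub>M * s\<^sup>2}" for s
  define R_V where "R_V = {s. 0 < s \<and>
     (\<forall>v. norm v \<le> s \<and> \<Psi> v \<le> \<rho> \<longrightarrow> \<bar>V_proc M Z w v\<bar> \<le> \<Lambda>\<^sub>V * s\<^sup>2)}"
  let ?R_Q = "{s. 0 < s \<and> prob (E_Q s) \<ge> 1 - p\<^sub>Q}"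
  let ?R_M = "{s. 0 < s \<and> prob (E_M s) \<ge> 1 - p\<^sub>M}"

  have mono_Q: "E_Q s \<subseteq> E_Q t" if "0 < s" "s \<le> t" for s t
  proof
    fix \<omega> assume "\<omega> \<in> E_Q s"
    then show "\<omega> \<in> E_Q t"
      using homogeneous_quadratic_bound_mono[where Q = "\<lambda>v. emp_avg N Zs (Q_proc v) \<omega>",
          OF norm emp_avg_Q_proc_scaleR that, where \<Lambda> = \<Lambda>\<^sub>Q and \<rho> = \<rho>]
      unfolding E_Q_def by blast
  qed
  have mono_M: "E_M s \<subseteq> E_M t" if "0 < s" "s \<le> t" for s t
  proof
    fix \<omega> assume "\<omega> \<in> E_M s"
    then show "\<omega> \<in> E_M t"
      using homogeneous_linear_bound_mono[where h = "\<lambda>v. emp_avg N Zs (M_proc M Z w v) \<omega>",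
          OF norm emp_avg_M_proc_scaleR that less_imp_le[OF Lambdas(2)], where \<rho> = \<rho>]
      unfolding E_M_def by blast
  qed
  \<comment> \<open>A bound linear in the norm falls below the quadratic one once \<open>s\<close>
    reaches \<open>C / \<Lambda>\<close>; this supplies the radii for \<open>?R_M\<close> and
    \<open>R_V\<close>.\<close>
  have linear_le: "C * norm v \<le> \<Lambda> * s\<^sup>2"
    if "0 < \<Lambda>" "0 \<le> C" "C / \<Lambda> \<le> s" "norm v \<le> s" for C \<Lambda> s and v :: "real ^ 'n"
  proof -
    have "C \<le> \<Lambda> * s" using that by (simp add: field_simps)
    then have "C * norm v \<le> (\<Lambda> * s) * s"
      using that by (intro mult_mono norm_ge_zero) linarith+
    then show ?thesis by (simp add: power2_eq_square mult.assoc)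
  qed

  have p_less: "p\<^sub>Q < 1" "p\<^sub>M < 1" using probs by auto
  have R_Q: "?R_Q \<noteq> {}"
  proof -
    obtain c where c: "0 < c" "\<And>v. c * norm v \<le> \<Psi> v" using is_norm_lower_bound[OF norm] by blast
    \<comment> \<open>This exceeds the Euclidean extent \<open>\<rho> / c\<close> of the
      \<open>\<Psi>\<close>-ball, so the sphere misses it and \<open>E_Q s\<close> holds
      vacuously.\<close>
    define s where "s = \<rho> / c + 1"
    have "\<rho> < c * s" using c by (simp add: s_def field_simps)
    then have "\<not> \<Psi> v \<le> \<rho>" if "norm v = s" for v using c(2)[of v] that by simp
    then have "E_Q s = space M" unfolding E_Q_def by blast
    moreover have "0 < s" using c rho by (simp add: s_def add_pos_pos)
    ultimately show ?thesis using probs by (auto simp: prob_space)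
  qed
  obtain A_Q where A_Q: "A_Q \<in> events" "prob A_Q \<ge> 1 - p\<^sub>Q" "\<And>s. Inf ?R_Q < s \<Longrightarrow> A_Q \<subseteq> E_Q s"
    using exists_event_of_Inf_threshold[of E_Q, OF mono_Q p_less(1) R_Q] by blast
  have R_M: "?R_M \<noteq> {}"
  proof -
    \<comment> \<open>The summand 1 keeps the radius positive even when
      \<open>K = 0\<close>.\<close>
    define s where "s = 2 * K / \<Lambda>\<^sub>M + 1"
    have "2 * K * norm v \<le> \<Lambda>\<^sub>M * s\<^sup>2" if "norm v \<le> s" for v :: "real ^ 'n"
      using that K0 Lambdas by (intro linear_le) (auto simp: s_def)
    then have "E_M s = space M"
      using order_trans[OF M_le] unfolding E_M_def by blast
    moreover have "0 < s" using K0 Lambdas by (simp add: s_def add_nonneg_pos)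
    ultimately show ?thesis using probs by (auto simp: prob_space)
  qed
  obtain A_M where A_M: "A_M \<in> events" "prob A_M \<ge> 1 - p\<^sub>M" "\<And>s. Inf ?R_M < s \<Longrightarrow> A_M \<subseteq> E_M s"
    using exists_event_of_Inf_threshold[of E_M, OF mono_M p_less(2) R_M] by blast
  have R_V: "R_V \<noteq> {}"
  proof -
    define s where "s = K / \<Lambda>\<^sub>V + 1"
    have "K * norm v \<le> \<Lambda>\<^sub>V * s\<^sup>2" if "norm v \<le> s" for v :: "real ^ 'n"
      using that K0 Lambdas by (intro linear_le) (auto simp: s_def)
    moreover have "0 < s" using K0 Lambdas by (simp add: s_def add_nonneg_pos)
    ultimately show ?thesis
      using order_trans[OF V_le] unfolding R_V_def by blast
  qed
  have V_bound: "\<bar>V_proc M Z w v\<bar> \<le> \<Lambda>\<^sub>V * s\<^sup>2"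
    if "Inf R_V < s" "norm v \<le> s" "\<Psi> v \<le> \<rho>" for s v
  proof -
    obtain t where "t \<in> R_V" "t < s" using cInf_lessD[OF R_V \<open>Inf R_V < s\<close>] by blast
    then show ?thesis
      using homogeneous_linear_bound_mono[where h = "V_proc M Z w", OF norm V_proc_scaleR,
          where s = t and t = s and \<Lambda> = \<Lambda>\<^sub>V and \<rho> = \<rho> and v = v] that Lambdas(3)
      by (auto simp: R_V_def)
  qed

  have r_eq: "r = Max {Inf ?R_Q, Inf ?R_M, Inf R_V}"
    unfolding r r_Q_eq r_M_eq r_V_eq E_Q_def E_M_def R_V_def ..
  then have r_ge: "Inf ?R_Q \<le> r" "Inf ?R_M \<le> r" "Inf R_V \<le> r" by auto
  have "0 \<le> Inf R_V" by (rule cInf_greatest[OF R_V]) (auto simp: R_V_def)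
  then have r0: "0 \<le> r" using r_ge by linarith

  let ?S = "{\<omega> \<in> space M. \<forall>\<theta>. \<theta> \<notin> cball w r \<inter> norm_ball \<Psi> w \<rho> \<longrightarrow>
             emp_avg N Zs (L_proc M Z w \<Psi> l (\<theta> - w)) \<omega> > 0}"
  have sub: "A_Q \<inter> A_M \<subseteq> ?S"
  proof
    fix \<omega> assume \<omega>: "\<omega> \<in> A_Q \<inter> A_M"
    have Q: "\<Lambda>\<^sub>Q * s\<^sup>2 \<le> emp_avg N Zs (Q_proc v) \<omega>" if "r < s" "norm v = s" "\<Psi> v \<le> \<rho>" for s v
      using A_Q(3)[of s] \<omega> that r_ge by (auto simp: E_Q_def)
    have h: "\<bar>emp_avg N Zs (?G v) \<omega>\<bar> \<le> (\<Lambda>\<^sub>M + \<Lambda>\<^sub>V) * s\<^sup>2"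
      if "r < s" "norm v \<le> s" "\<Psi> v \<le> \<rho>" for s v
    proof -
      have "\<omega> \<in> E_M s" using A_M(3)[of s] \<omega> that r_ge by auto
      then have "\<bar>emp_avg N Zs (M_proc M Z w v) \<omega>\<bar> \<le> \<Lambda>\<^sub>M * s\<^sup>2"
        using that by (simp add: E_M_def)
      moreover have "\<bar>V_proc M Z w v\<bar> \<le> \<Lambda>\<^sub>V * s\<^sup>2" using that r_ge by (intro V_bound) auto
      ultimately show ?thesis
        unfolding emp_avg_M_proc[OF N] distrib_right by linarith
    qed
    have "0 < emp_avg N Zs (L_proc M Z w \<Psi> l (\<theta> - w)) \<omega>"
      if "\<theta> \<notin> cball w r \<inter> norm_ball \<Psi> w \<rho>" for \<theta>
      unfolding emp_avg_L_proc[OF N]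
    proof (rule regularized_loss_positive_outside[OF norm rho r0,
          where Q = "\<lambda>v. emp_avg N Zs (Q_proc v) \<omega>" and h = "\<lambda>v. emp_avg N Zs (?G v) \<omega>" and \<Lambda>\<^sub>Q = \<Lambda>\<^sub>Q
          and \<Lambda> = "\<Lambda>\<^sub>M + \<Lambda>\<^sub>V" and c\<^sub>1 = c\<^sub>1 and c\<^sub>2 = c\<^sub>2])
      show "r < norm (\<theta> - w) \<or> \<rho> < \<Psi> (\<theta> - w)"
        using that by (auto simp: norm_ball_def dist_norm norm_minus_commute)
    next
      show "emp_avg N Zs (?G (c *\<^sub>R v)) \<omega> = c * emp_avg N Zs (?G v) \<omega>" for c v
        by (simp add: emp_avg_def sum_distrib_left mult.left_commute)
    qed (fact emp_avg_Q_proc_scaleR emp_avg_Q_proc_nonneg Q h Lambdas(1) lambda constants gap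
        add_pos_pos[OF Lambdas(2,3)])+
    moreover have "\<omega> \<in> space M" using \<omega> A_Q(1) sets.sets_into_space by blast
    ultimately show "\<omega> \<in> ?S" by blast
  qed
  \<comment> \<open>Monotonicity of the measure requires this, since a non-measurable
    \<open>?S\<close> would have measure 0.\<close>
  have S: "?S \<in> events"
  proof -
    let ?F = "\<lambda>\<theta> \<omega>. emp_avg N Zs (L_proc M Z w \<Psi> l (\<theta> - w)) \<omega>"
    note Psi_cont = is_norm_continuous[OF norm]
    have "closed (cball w r \<inter> norm_ball \<Psi> w \<rho>)"
      unfolding norm_ball_def
      by (intro closed_Int closed_cball closed_Collect_le continuous_intros
          continuous_on_compose2[OF Psi_cont]) auto
    then have "{\<omega> \<in> space M. \<forall>\<theta>\<in>- (cball w r \<inter> norm_ball \<Psi> w \<rho>). 0 < ?F \<theta> \<omega>} \<in> events"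
    proof (intro sets_Ball_pos_open)
      show "continuous_on (- (cball w r \<inter> norm_ball \<Psi> w \<rho>)) (\<lambda>\<theta>. ?F \<theta> \<omega>)" for \<omega>
        unfolding emp_avg_L_proc[OF N]
        unfolding emp_avg_def Q_proc_def
        by (intro continuous_intros continuous_on_compose2[OF Psi_cont]) (use N in auto)
      show "?F \<theta> \<in> borel_measurable M" for \<theta>
      proof -
        have "(\<lambda>\<omega>. fst (Zs i \<omega>)) \<in> borel_measurable M" "(\<lambda>\<omega>. snd (Zs i \<omega>)) \<in> borel_measurable M"
          if "i < N" for i
          by (rule measurable_compose[OF Zs_meas[OF that]],
              intro borel_measurable_continuous_onI continuous_intros)+
        then show ?thesis
          unfolding emp_avg_L_proc[OF N]
          unfolding emp_avg_def Q_proc_def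
          by (intro borel_measurable_add borel_measurable_diff borel_measurable_times
              borel_measurable_divide borel_measurable_sum borel_measurable_power
              borel_measurable_inner borel_measurable_const) auto
      qed
    qed (simp only: open_Compl)
    then show ?thesis by (simp only: Ball_def Compl_iff)
  qed
  \<comment> \<open>Inclusion-exclusion with the union bounded by 1; the two events may be
    dependent.\<close>
  have "prob A_Q + prob A_M - 1 \<le> prob (A_Q \<inter> A_M)"
  proof -
    have "prob (A_Q \<union> A_M) = prob A_Q + prob A_M - prob (A_Q \<inter> A_M)"
      using A_Q(1) A_M(1) by (intro measure_Un3) (auto simp: fmeasurable_eq_sets)
    then show ?thesis using prob_le_1[of "A_Q \<union> A_M"] by linarith
  qed
  also have "\<dots> \<le> prob ?S" by (rule finite_measure_mono[OF sub S])
  finally show ?thesis using A_Q(2) A_M(2) by linarith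
qed

end
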